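(* Let $\lambda_{\mathrm{reg}}>0$. For each $N$ let $\alpha(t,N)$, $t\ge 0$, be random network parameters (the training path) with loss $L$, and suppose: (1) for each $N$, $\alpha(t,N)\to\alpha^*(N)$ in probability as $t\to\infty$; (2) the distinguished layer matrix $W^*(N)$ of $\alpha^*(N)$ admits an admissible decomposition $W^*(N)=S^*(N)+R^*(N)$ (i.e. the General Architecture and Perturbative Random Component assumptions of the context hold for the network with parameters $\alpha^*(N)$, with $S=S^*(N)$, $R=R^*(N)$) satisfying $\langle S^*(N),R^*(N)\rangle_F\to0$ in probability as $N\to\infty$. Assume further that for all $s\in T$, $a_\phi(N,s)\to0$ as $N\to\infty$ (in probability if these quantities are random). For $\vartheta\in[0,1]$ let $\alpha_\vartheta^*(N)$ be the parameter vector obtained from $\alpha^*(N)$ by replacing $W^*(N)$ with $S^*(N)+\vartheta R^*(N)$. Assume there exist nonnegative random variables $\epsilon_N$ with $\epsilon_N\to 0$ in probability such that the event $$\liminf_{h\downarrow0}\frac{L(\alpha_{1-h}^*(N))-L(\alpha^*(N))}{h}\ge-\epsilon_N$$ has probability tending to one as $N\to\infty$. Define $\bar a_{\phi,N}:=\frac{2}{|T|}\sum_{s\in T}a_\phi(N,s)$. Then $$\|R^*(N)\|_F^2\le\frac{\bar a_{\phi,N}+\epsilon_N}{2\lambda_{\mathrm{reg}}}+o_{\mathbb P}(1)\qquad(N\to\infty).$$ In particular, if $\bar a_{\phi,N}+\epsilon_N\to0$ in probability, then for every $\epsilon>0$, $\lim_{N\to\infty}\mathbb P(\|R^*(N)\|_F\le\epsilon)=1$.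 If, in addition, there is a decomposition $W(t,N)=S(t,N)+R(t,N)$ of the distinguished layer matrix of $\alpha(t,N)$ along the training path such that for each fixed $N$ $$\|S(t,N)-S^*(N)\|_F+\|R(t,N)-R^*(N)\|_F\to0\quad\text{in probability as }t\to\infty,$$ and if for every fixed $N$ and every $\epsilon>0$ one has $\mathbb P(\|R^*(N)\|_F=\epsilon)=0$, then for every $\epsilon>0$ $$\lim_{N\to\infty}\lim_{t\to\infty}\mathbb P\big(\|R(t,N)\|_F\le\epsilon\big)=1.$$
   Context: Setting. For each size parameter $N$ there is a classifier network $\phi(\cdot,\alpha)=\rho\circ X(\cdot,\alpha)$ with $K$ classes and parameters $\alpha$ including weight matrices $W_1,\dots,W_{L}$ of its layers; $\rho(v)_i=e^{v_i}/\sum_{j=1}^K e^{v_j}$ is softmax and $X(s,\alpha)\in\mathbb R^K$ are the logits. $T$ is a finite nonempty training set, fixed independently of $N$, and $C(s)\in\{1,\dots,K\}$ is the correct class of $s\in T$. The loss is $$L(\alpha)=-\frac1{|T|}\sum_{s\in T}\log\big(\phi_{C(s)}(s,\alpha)\big)+\lambda_{\mathrm{reg}}\sum_{i}\|W_i\|_F^2,$$ the sum being over all layers. One distinguished layer has $N\times M_N$ weight matrix $W=S+R$ ($S$, $R$ possibly random). General Architecture assumption. $\phi=\rho\circ\psi_2\circ(R+S)\circ\psi_1$, where $\psi_1$ (values in $\mathbb R^{M_N}$) and $\psi_2:\mathbb R^N\to\mathbb R^K$ may depend on $N$ and on the remaining parameters. For each $s\in T$, $\mathcal U_s$ is a set containing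 $\{(S+\vartheta R)\psi_1(s):\vartheta\in[0,1]\}$, and $$L_{\psi_2}(s):=\sup_{v,w\in\mathcal U_s,\,v\ne w}\frac{\|\psi_2(v)-\psi_2(w)\|_\infty}{\|v-w\|_\infty}<\infty.$$ Perturbative Random Component assumption. There are nonnegative $d_1(N),d_2(N)\to0$ and a nonnegative function $J(v)$ depending only on $v$ such that for every $v$ measurable with respect to $\sigma(S,\psi_1,\psi_2)$ (including deterministic $v$), $$\mathbb P\big(\|Rv\|_\infty>d_1(N)J(v)\,\big|\,S,\psi_1,\psi_2\big)\le d_2(N).$$ Notation. $h_\phi(s):=J(\psi_1(s))L_{\psi_2}(s)$ and $a_\phi(N,s):=h_\phi(s)d_1(N)$. $\langle\cdot,\cdot\rangle_F$ and $\|\cdot\|_F$ are the Frobenius inner product and norm; $\|\cdot\|_\infty$ of a vector is the maximum norm; $o_{\mathbb P}(1)$ is a sequence of random variables tending to $0$ in probability. *)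

theory Defs
  imports
    "HOL-Probability.Conditional_Expectation"
    "Jordan_Normal_Form.Matrix"
begin

text \<open>
  Matrix dimensions vary with the size parameter \<open>N\<close>, so vectors and matrices are the
  carrier-based ones of \<^theory>\<open>Jordan_Normal_Form.Matrix\<close>; all indices (entries, classes, layers)
  start at \<open>0\<close>.
\<close>

no_notation Finite_Cartesian_Product.vec_nth (infixl \<open>$\<close> 90)
hide_type (open) Finite_Cartesian_Product.vec
hide_const (open) Finite_Cartesian_Product.vec

text \<open>Inserting \<open>0\<close> only matters for the vector of dimension \<open>0\<close>.\<close>

definition max_norm :: "real vec \<Rightarrow> real" where
  "max_norm v = Max (insert 0 ((\<lambda>i. \<bar>v $ i\<bar>) ` {..<dim_vec v}))"

definition frob_inner :: "real mat \<Rightarrow> real mat \<Rightarrow> real" where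
  "frob_inner A B = (\<Sum>i<dim_row A. \<Sum>j<dim_col A. A $$ (i, j) * B $$ (i, j))"

definition frob_norm :: "real mat \<Rightarrow> real" where
  "frob_norm A = sqrt (frob_inner A A)"

text \<open>Best Lipschitz constant of \<open>f\<close> on \<open>U\<close>; the supremum over no pairs is \<open>0\<close> in \<^typ>\<open>ennreal\<close>.\<close>

definition lip_const :: "(real vec \<Rightarrow> real vec) \<Rightarrow> real vec set \<Rightarrow> ennreal" where
  "lip_const f U =
     (SUP (v, w) \<in> {(v, w). v \<in> U \<and> w \<in> U \<and> v \<noteq> w}.
        ennreal (max_norm (f v - f w) / max_norm (v - w)))"

datatype params = Params (weights: "real mat list") (others: "real vec")

text \<open>\<open>ds\<close> lists the dimensions of the weight matrices; \<open>p\<close> is the number of other parameters.\<close>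

definition param_space :: "(nat \<times> nat) list \<Rightarrow> nat \<Rightarrow> params set" where
  "param_space ds p =
     {a. length (weights a) = length ds \<and>
         (\<forall>i<length ds. weights a ! i \<in> carrier_mat (fst (ds ! i)) (snd (ds ! i))) \<and>
         others a \<in> carrier_vec p}"

definition set_layer :: "nat \<Rightarrow> real mat \<Rightarrow> params \<Rightarrow> params" where
  "set_layer l V a = Params ((weights a)[l := V]) (others a)"

text \<open>Euclidean distance of two parameter vectors of the same shape.\<close>

definition param_dist :: "params \<Rightarrow> params \<Rightarrow> real" where
  "param_dist a b =
     sqrt ((\<Sum>i<length (weights a). (frob_norm (weights a ! i - weights b ! i))\<^sup>2) +
           (\<Sum>i<dim_vec (others a). (others a $ i - others b $ i)\<^sup>2))"

definition softmax :: "real vec \<Rightarrow> real vec" where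
  "softmax v = Matrix.vec (dim_vec v) (\<lambda>i. exp (v $ i) / (\<Sum>j<dim_vec v. exp (v $ j)))"

definition classifier :: "('s \<Rightarrow> params \<Rightarrow> real vec) \<Rightarrow> 's \<Rightarrow> params \<Rightarrow> real vec" where
  "classifier X s a = softmax (X s a)"

definition loss ::
  "'s set \<Rightarrow> ('s \<Rightarrow> nat) \<Rightarrow> real \<Rightarrow> ('s \<Rightarrow> params \<Rightarrow> real vec) \<Rightarrow> params \<Rightarrow> real" where
  "loss T C lam X a =
     - (1 / real (card T)) * (\<Sum>s\<in>T. ln (classifier X s a $ C s)) +
     lam * (\<Sum>i<length (weights a). (frob_norm (weights a ! i))\<^sup>2)"

definition random_vec :: "'w measure \<Rightarrow> nat \<Rightarrow> ('w \<Rightarrow> real vec) \<Rightarrow> bool" where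
  "random_vec P n v \<longleftrightarrow>
     (\<forall>\<omega>\<in>space P. v \<omega> \<in> carrier_vec n) \<and>
     (\<forall>i<n. (\<lambda>\<omega>. v \<omega> $ i) \<in> borel_measurable P)"

definition random_mat :: "'w measure \<Rightarrow> nat \<Rightarrow> nat \<Rightarrow> ('w \<Rightarrow> real mat) \<Rightarrow> bool" where
  "random_mat P n m A \<longleftrightarrow>
     (\<forall>\<omega>\<in>space P. A \<omega> \<in> carrier_mat n m) \<and>
     (\<forall>i<n. \<forall>j<m. (\<lambda>\<omega>. A \<omega> $$ (i, j)) \<in> borel_measurable P)"

definition random_params ::
  "'w measure \<Rightarrow> (nat \<times> nat) list \<Rightarrow> nat \<Rightarrow> ('w \<Rightarrow> params) \<Rightarrow> bool" where
  "random_params P ds p a \<longleftrightarrow>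
     (\<forall>\<omega>\<in>space P. a \<omega> \<in> param_space ds p) \<and>
     (\<forall>i<length ds. random_mat P (fst (ds ! i)) (snd (ds ! i)) (\<lambda>\<omega>. weights (a \<omega>) ! i)) \<and>
     random_vec P p (\<lambda>\<omega>. others (a \<omega>))"

text \<open>
  Convergence to \<open>0\<close> in probability. The variables may live on different probability spaces, as
  is usual for a deterministic limit. Measurability is part of the notion because
  \<^const>\<open>measure\<close> assigns \<open>0\<close> to every set that is not an event.
\<close>

definition tendsto_0_in_prob :: "('i \<Rightarrow> 'w measure) \<Rightarrow> ('i \<Rightarrow> 'w \<Rightarrow> real) \<Rightarrow> 'i filter \<Rightarrow> bool" where
  "tendsto_0_in_prob P Y F \<longleftrightarrow>
     (\<forall>\<^sub>F i in F. Y i \<in> borel_measurable (P i)) \<and>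
     (\<forall>e>0. ((\<lambda>i. measure (P i) {\<omega> \<in> space (P i). \<bar>Y i \<omega>\<bar> > e}) \<longlongrightarrow> 0) F)"

text \<open>
  The network factors as \<open>\<rho> \<circ> \<psi>2 \<circ> W \<circ> \<psi>1\<close>, where \<open>W\<close> is the \<open>n \<times> m\<close> matrix of layer \<open>l\<close>. The maps
  \<open>\<psi>1\<close> and \<open>\<psi>2\<close> take the full parameters as an argument but do not depend on \<open>W\<close>.
\<close>

definition factors_through_layer ::
  "(nat \<times> nat) list \<Rightarrow> nat \<Rightarrow> nat \<Rightarrow> nat \<Rightarrow> nat \<Rightarrow> nat \<Rightarrow> ('s \<Rightarrow> params \<Rightarrow> real vec) \<Rightarrow>
   (params \<Rightarrow> 's \<Rightarrow> real vec) \<Rightarrow> (params \<Rightarrow> real vec \<Rightarrow> real vec) \<Rightarrow> bool" where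
  "factors_through_layer ds p l n m K X \<psi>1 \<psi>2 \<longleftrightarrow>
     l < length ds \<and> ds ! l = (n, m) \<and>
     (\<forall>a\<in>param_space ds p.
        (\<forall>s. X s a \<in> carrier_vec K) \<and>
        (\<forall>s. \<psi>1 a s \<in> carrier_vec m) \<and>
        (\<forall>v\<in>carrier_vec n. \<psi>2 a v \<in> carrier_vec K) \<and>
        (\<forall>V\<in>carrier_mat n m. \<psi>1 (set_layer l V a) = \<psi>1 a \<and> \<psi>2 (set_layer l V a) = \<psi>2 a) \<and>
        (\<forall>s. classifier X s a = softmax (\<psi>2 a (weights a ! l *\<^sub>v \<psi>1 a s))))"

text \<open>The condition on \<open>\<U>\<^sub>s\<close> for one realization of \<open>S\<close>, \<open>R\<close>, \<open>\<psi>1\<close>, \<open>\<psi>2\<close>.\<close>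

definition lipschitz_near_segment ::
  "'s set \<Rightarrow> nat \<Rightarrow> real mat \<Rightarrow> real mat \<Rightarrow> ('s \<Rightarrow> real vec) \<Rightarrow> (real vec \<Rightarrow> real vec) \<Rightarrow>
   ('s \<Rightarrow> real vec set) \<Rightarrow> bool" where
  "lipschitz_near_segment T n S R f g U \<longleftrightarrow>
     (\<forall>s\<in>T. U s \<subseteq> carrier_vec n \<and>
        {(S + \<theta> \<cdot>\<^sub>m R) *\<^sub>v f s | \<theta>. \<theta> \<in> {0..1}} \<subseteq> U s \<and>
        lip_const g (U s) < \<infinity>)"

definition generated_sigma :: "'w measure \<Rightarrow> ('w \<Rightarrow> real) set \<Rightarrow> 'w measure" where
  "generated_sigma P G = sigma (space P) {g -` B \<inter> space P | g B. g \<in> G \<and> B \<in> sets borel}"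

text \<open>
  The sigma-algebra \<open>\<sigma>(S, \<psi>1, \<psi>2)\<close>; a random function generates the sigma-algebra of all its
  evaluations.
\<close>

definition decomposition_sigma ::
  "'w measure \<Rightarrow> nat \<Rightarrow> nat \<Rightarrow> nat \<Rightarrow> ('w \<Rightarrow> real mat) \<Rightarrow> ('w \<Rightarrow> 's \<Rightarrow> real vec) \<Rightarrow>
   ('w \<Rightarrow> real vec \<Rightarrow> real vec) \<Rightarrow> 'w measure" where
  "decomposition_sigma P n m K S f g = generated_sigma P
     ({\<lambda>\<omega>. S \<omega> $$ (i, j) | i j. i < n \<and> j < m} \<union>
      {\<lambda>\<omega>. f \<omega> s $ i | s i. i < m} \<union>
      {\<lambda>\<omega>. g \<omega> v $ k | v k. v \<in> carrier_vec n \<and> k < K})"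

text \<open>
  The conditional probability is the conditional expectation of the indicator. That the
  conditioning sigma-algebra is contained in that of the probability space, and that the
  sets in question are events, is what it takes for that conditional probability to make sense.
\<close>

definition perturbation_bound ::
  "'w measure \<Rightarrow> nat \<Rightarrow> nat \<Rightarrow> nat \<Rightarrow> real \<Rightarrow> real \<Rightarrow> (real vec \<Rightarrow> real) \<Rightarrow> ('w \<Rightarrow> real mat) \<Rightarrow>
   ('w \<Rightarrow> real mat) \<Rightarrow> ('w \<Rightarrow> 's \<Rightarrow> real vec) \<Rightarrow> ('w \<Rightarrow> real vec \<Rightarrow> real vec) \<Rightarrow> bool" where
  "perturbation_bound P n m K d1 d2 J S R f g \<longleftrightarrow>
     (let F = decomposition_sigma P n m K S f g in
        subalgebra P F \<and>
        (\<forall>v. random_vec F m v \<longrightarrow>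
           (let E = {\<omega> \<in> space P. max_norm (R \<omega> *\<^sub>v v \<omega>) > d1 * J (v \<omega>)} in
              E \<in> sets P \<and> (AE \<omega> in P. real_cond_exp P F (indicator E) \<omega> \<le> d2))))"

text \<open>Here \<open>m N\<close> is the number of columns of the distinguished layer, which has \<open>N\<close> rows.\<close>

definition perturbative_random_component ::
  "(nat \<Rightarrow> 'w measure) \<Rightarrow> (nat \<Rightarrow> nat) \<Rightarrow> nat \<Rightarrow> (nat \<Rightarrow> real) \<Rightarrow> (nat \<Rightarrow> real) \<Rightarrow>
   (real vec \<Rightarrow> real) \<Rightarrow> (nat \<Rightarrow> 'w \<Rightarrow> real mat) \<Rightarrow> (nat \<Rightarrow> 'w \<Rightarrow> real mat) \<Rightarrow>
   (nat \<Rightarrow> 'w \<Rightarrow> 's \<Rightarrow> real vec) \<Rightarrow> (nat \<Rightarrow> 'w \<Rightarrow> real vec \<Rightarrow> real vec) \<Rightarrow> bool" where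
  "perturbative_random_component P m K d1 d2 J S R f g \<longleftrightarrow>
     (\<forall>N\<ge>1. d1 N \<ge> 0 \<and> d2 N \<ge> 0) \<and> d1 \<longlonglongrightarrow> 0 \<and> d2 \<longlonglongrightarrow> 0 \<and> (\<forall>v. J v \<ge> 0) \<and>
     (\<forall>N\<ge>1. perturbation_bound (P N) N (m N) K (d1 N) (d2 N) J (S N) (R N) (f N) (g N))"

definition h_phi ::
  "(real vec \<Rightarrow> real) \<Rightarrow> ('s \<Rightarrow> real vec) \<Rightarrow> (real vec \<Rightarrow> real vec) \<Rightarrow> ('s \<Rightarrow> real vec set) \<Rightarrow>
   's \<Rightarrow> real" where
  "h_phi J f g U s = J (f s) * enn2real (lip_const g (U s))"

definition a_phi ::
  "real \<Rightarrow> (real vec \<Rightarrow> real) \<Rightarrow> ('s \<Rightarrow> real vec) \<Rightarrow> (real vec \<Rightarrow> real vec) \<Rightarrow>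
   ('s \<Rightarrow> real vec set) \<Rightarrow> 's \<Rightarrow> real" where
  "a_phi d1 J f g U s = h_phi J f g U s * d1"

definition a_bar ::
  "'s set \<Rightarrow> real \<Rightarrow> (real vec \<Rightarrow> real) \<Rightarrow> ('s \<Rightarrow> real vec) \<Rightarrow> (real vec \<Rightarrow> real vec) \<Rightarrow>
   ('s \<Rightarrow> real vec set) \<Rightarrow> real" where
  "a_bar T d1 J f g U = 2 / real (card T) * (\<Sum>s\<in>T. a_phi d1 J f g U s)"

end

theory Submission
  imports Defs
begin

text \<open>
  Shrinking \<open>R\<close> to \<open>(1 - h) R\<close> moves each input of \<open>\<psi>2\<close> by \<open>h R \<psi>1(s)\<close>, hence the logits by at most
  \<open>h a(s)\<close> off an event of probability at most \<open>d2\<close>. As \<open>ln \<circ> softmax\<close> is \<open>2\<close>-Lipschitz for the maximum norm,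
  the data part of the loss grows by at most \<open>h abar\<close>, whereas the regularization changes by
  \<open>- 2 h lam (\<langle>S, R\<rangle> + \<parallel>R\<parallel>\<^sup>2) + O(h\<^sup>2)\<close>. Dividing by \<open>h\<close> and letting \<open>h\<close> tend to \<open>0\<close>, almost-minimality
  yields \<open>\<parallel>R\<parallel>\<^sup>2 \<le> (abar + \<epsilon>) / (2 lam) - \<langle>S, R\<rangle>\<close>. For the training path, convergence in probability
  implies convergence of the distribution function at its continuity points.
\<close>

section \<open>Norms of vectors and matrices\<close>

text \<open>The conjunct \<open>0 \<le> c\<close> comes from the \<open>0\<close> inserted in the
  maximum. In dimension \<open>0\<close> it is the whole condition.\<close>

lemma max_norm_le_iff: "max_norm v \<le> c \<longleftrightarrow> 0 \<le> c \<and> (\<forall>i<dim_vec v. \<bar>v $ i\<bar> \<le> c)"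
  unfolding max_norm_def by (subst Max_le_iff) auto

lemma max_norm_nonneg: "0 \<le> max_norm v"
  unfolding max_norm_def by (rule Max_ge) auto

lemma abs_index_le_max_norm: "i < dim_vec v \<Longrightarrow> \<bar>v $ i\<bar> \<le> max_norm v"
  using max_norm_le_iff[of v "max_norm v"] by simp

lemma max_norm_minus_pos:
  assumes "v \<in> carrier_vec n" "w \<in> carrier_vec n" "v \<noteq> w"
  shows "0 < max_norm (v - w)"
proof -
  obtain i where "i < n" "v $ i \<noteq> w $ i"
    using assms by (metis carrier_vecD eq_vecI)
  then have "0 < \<bar>(v - w) $ i\<bar>" "i < dim_vec (v - w)" using assms by auto
  then show ?thesis using abs_index_le_max_norm[of i "v - w"] by linarith
qed

lemma max_norm_smult_le: "max_norm (c \<cdot>\<^sub>v v) \<le> \<bar>c\<bar> * max_norm v"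
  by (auto simp: max_norm_le_iff max_norm_nonneg abs_mult
      intro!: mult_left_mono abs_index_le_max_norm)

text \<open>Passes from the supremum in \<open>ennreal\<close> to a usable real estimate. Finiteness
  matters because \<open>enn2real\<close> sends infinity to \<open>0\<close>; equal points are
  treated apart because the supremum ranges over distinct ones only.\<close>

lemma lip_const_bound:
  assumes U: "U \<subseteq> carrier_vec n" and fin: "lip_const f U < \<infinity>" and vw: "v \<in> U" "w \<in> U"
  shows "max_norm (f v - f w) \<le> enn2real (lip_const f U) * max_norm (v - w)"
proof (cases "v = w")
  case True
  have "max_norm (f w - f w) \<le> 0" by (auto simp: max_norm_le_iff)
  then show ?thesis using True by (smt (verit) enn2real_nonneg max_norm_nonneg mult_nonneg_nonneg)
next
  case False
  then have pos: "0 < max_norm (v - w)" using U vw by (intro max_norm_minus_pos) auto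
  have "ennreal (max_norm (f v - f w) / max_norm (v - w)) \<le> lip_const f U"
    unfolding lip_const_def by (rule SUP_upper2[of "(v, w)"]) (use vw False in auto)
  then have "enn2real (ennreal (max_norm (f v - f w) / max_norm (v - w))) \<le> enn2real (lip_const f U)"
    using fin by (intro enn2real_mono) auto
  then have "max_norm (f v - f w) / max_norm (v - w) \<le> enn2real (lip_const f U)"
    using max_norm_nonneg[of "f v - f w"] pos by simp
  then show ?thesis using pos by (simp add: divide_le_eq)
qed

lemma frob_norm_power2: "(frob_norm A)\<^sup>2 = frob_inner A A"
  unfolding frob_norm_def frob_inner_def by (intro real_sqrt_pow2 sum_nonneg) auto

lemma frob_norm_nonneg: "0 \<le> frob_norm A"
  unfolding frob_norm_def frob_inner_def by (intro real_sqrt_ge_zero sum_nonneg) auto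

text \<open>With \<open>c = 1 - h\<close> and \<open>c = 1\<close> this expansion gives the exact
  change of the regularizer, including the term of second order in \<open>h\<close>.\<close>

lemma frob_norm_add_smult_power2:
  assumes "S \<in> carrier_mat n m" "R \<in> carrier_mat n m"
  shows "(frob_norm (S + c \<cdot>\<^sub>m R))\<^sup>2 =
    (frob_norm S)\<^sup>2 + 2 * c * frob_inner S R + c\<^sup>2 * (frob_norm R)\<^sup>2"
  using assms unfolding frob_norm_power2
  by (auto simp: frob_inner_def sum_distrib_left sum.distrib[symmetric]
      algebra_simps power2_eq_square intro!: sum.cong)

text \<open>Reading a matrix as a finite family indexed by pairs makes the triangle inequality of
  \<open>L2_set\<close> available.\<close>

lemma frob_norm_eq_L2_set:
  assumes "A \<in> carrier_mat n m"
  shows "frob_norm A = L2_set (\<lambda>x. A $$ x) ({..<n} \<times> {..<m})"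
  using assms
  by (simp add: frob_norm_def frob_inner_def L2_set_def sum.cartesian_product power2_eq_square
      case_prod_unfold)

text \<open>The triangle inequality is applied to \<open>A\<close> as the sum of
  \<open>A - B\<close> and \<open>B\<close>, and once more with the roles exchanged. This later
  transfers convergence from matrices to their norms.\<close>

lemma frob_norm_diff_le:
  assumes A: "A \<in> carrier_mat n m" and B: "B \<in> carrier_mat n m"
  shows "\<bar>frob_norm A - frob_norm B\<bar> \<le> frob_norm (A - B)"
proof -
  let ?I = "{..<n} \<times> {..<m}"
  have le: "frob_norm D \<le> frob_norm (D - E) + frob_norm E"
    if D: "D \<in> carrier_mat n m" and E: "E \<in> carrier_mat n m" for D E :: "real mat"
  proof -
    have "L2_set (\<lambda>x. D $$ x) ?I = L2_set (\<lambda>x. (D - E) $$ x + E $$ x) ?I"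
      using D E by (intro L2_set_cong) auto
    also have "\<dots> \<le> L2_set (\<lambda>x. (D - E) $$ x) ?I + L2_set (\<lambda>x. E $$ x) ?I"
      by (rule L2_set_triangle_ineq)
    finally show ?thesis
      using D E by (simp add: frob_norm_eq_L2_set[of _ n m] minus_carrier_mat)
  qed
  have "frob_norm (B - A) = frob_norm (A - B)"
    using A B by (auto simp: frob_norm_def frob_inner_def algebra_simps intro!: sum.cong)
  then show ?thesis using le[OF A B] le[OF B A] by linarith
qed

text \<open>The sum in \<open>frob_inner\<close> runs up to dimensions that formally depend on
  \<omega>, and \<open>random_mat\<close> controls entries only inside the fixed shape. Hence the
  passage to sums with bounds \<open>n\<close> and \<open>m\<close>, which agree with it on the
  space.\<close>

lemma frob_inner_measurable:
  assumes "random_mat P n m A" "random_mat P n m B"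
  shows "(\<lambda>\<omega>. frob_inner (A \<omega>) (B \<omega>)) \<in> borel_measurable P"
proof -
  have "(\<lambda>\<omega>. \<Sum>i<n. \<Sum>j<m. A \<omega> $$ (i, j) * B \<omega> $$ (i, j)) \<in> borel_measurable P"
    using assms by (intro borel_measurable_sum borel_measurable_times) (auto simp: random_mat_def)
  then show ?thesis
    using assms by (subst measurable_cong) (auto simp: frob_inner_def random_mat_def)
qed

lemma frob_norm_measurable:
  assumes "random_mat P n m A"
  shows "(\<lambda>\<omega>. frob_norm (A \<omega>)) \<in> borel_measurable P"
  unfolding frob_norm_def using frob_inner_measurable[OF assms assms] by measurable

section \<open>The loss along the segment\<close>

text \<open>The logarithm of softmax is a coordinate minus log-sum-exp. Both are 1-Lipschitz for the
  maximum norm, whence the constant \<open>2\<close>, which reappears as the \<open>2\<close> in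
  \<open>a_bar\<close>.\<close>

lemma ln_softmax_lipschitz:
  assumes v: "v \<in> carrier_vec K" and w: "w \<in> carrier_vec K" and c: "c < K"
  shows "\<bar>ln (softmax v $ c) - ln (softmax w $ c)\<bar> \<le> 2 * max_norm (v - w)"
proof -
  have ln_softmax: "ln (softmax u $ c) = u $ c - ln (\<Sum>j<K. exp (u $ j))" 
    and pos: "0 < (\<Sum>j<K. exp (u $ j))" if "u \<in> carrier_vec K" for u :: "real vec"
  proof -
    show pos: "0 < (\<Sum>j<K. exp (u $ j))" using c by (intro sum_pos) auto
    show "ln (softmax u $ c) = u $ c - ln (\<Sum>j<K. exp (u $ j))"
      using that c pos by (simp add: softmax_def ln_div)
  qed
  define D where "D = max_norm (v - w)"
  have D: "\<bar>v $ j - w $ j\<bar> \<le> D" if "j < K" for j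
    using abs_index_le_max_norm[of j "v - w"] v w that by (simp add: D_def)
  \<comment> \<open>Log-sum-exp is monotone, and adding \<open>D\<close> to every coordinate adds
    \<open>D\<close> to its value.\<close>
  have le: "ln (\<Sum>j<K. exp (x $ j)) \<le> D + ln (\<Sum>j<K. exp (y $ j))"
    if "x \<in> carrier_vec K" "y \<in> carrier_vec K" "\<And>j. j < K \<Longrightarrow> x $ j \<le> y $ j + D" for x y
  proof -
    have "(\<Sum>j<K. exp (x $ j)) \<le> (\<Sum>j<K. exp D * exp (y $ j))"
      using that(3) by (intro sum_mono) (auto simp: exp_add[symmetric] add.commute)
    also have "\<dots> = exp D * (\<Sum>j<K. exp (y $ j))" by (simp add: sum_distrib_left)
    finally have "ln (\<Sum>j<K. exp (x $ j)) \<le> ln (exp D * (\<Sum>j<K. exp (y $ j)))"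
      using pos[OF that(1)] pos[OF that(2)] by (subst ln_le_cancel_iff) auto
    then show ?thesis using pos[OF that(2)] by (simp add: ln_mult)
  qed
  have "ln (\<Sum>j<K. exp (v $ j)) \<le> D + ln (\<Sum>j<K. exp (w $ j))"
    using D by (intro le v w) (smt (verit))
  moreover have "ln (\<Sum>j<K. exp (w $ j)) \<le> D + ln (\<Sum>j<K. exp (v $ j))"
    using D by (intro le v w) (smt (verit))
  ultimately show ?thesis
    using D[OF c] ln_softmax[OF v] ln_softmax[OF w] unfolding D_def by linarith
qed

text \<open>Neither \<psi>1 nor \<psi>2 reads the matrix of layer \<open>l\<close>, so both may
  still be evaluated at the original parameters.\<close>

lemma classifier_set_layer:
  assumes arch: "factors_through_layer ds p l n m K X \<psi>1 \<psi>2"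
    and a: "a \<in> param_space ds p" and V: "V \<in> carrier_mat n m"
  shows "classifier X s (set_layer l V a) = softmax (\<psi>2 a (V *\<^sub>v \<psi>1 a s))"
proof -
  have l: "l < length ds" "ds ! l = (n, m)" using arch by (auto simp: factors_through_layer_def)
  then have "set_layer l V a \<in> param_space ds p"
    using a V by (auto simp: param_space_def set_layer_def nth_list_update)
  then have "classifier X s (set_layer l V a) =
      softmax (\<psi>2 (set_layer l V a) (weights (set_layer l V a) ! l *\<^sub>v \<psi>1 (set_layer l V a) s))"
    using arch by (auto simp: factors_through_layer_def)
  moreover have "weights (set_layer l V a) ! l = V"
    using l a by (auto simp: set_layer_def param_space_def)
  ultimately show ?thesis using arch a V by (auto simp: factors_through_layer_def)
qed

text \<open>The deterministic core, for a single realization: the perturbation bound enters as the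
  plain inequality \<open>pert\<close>. The last summand is the second-order part of the regularizer
  and vanishes after division by \<open>h\<close> as \<open>h\<close> tends to
  \<open>0\<close>.\<close>

lemma loss_increment_le:
  assumes arch: "factors_through_layer ds p l n m K X \<psi>1 \<psi>2"
    and a: "a \<in> param_space ds p"
    and S: "S \<in> carrier_mat n m" and R: "R \<in> carrier_mat n m"
    and W: "weights a ! l = S + R"
    and lip: "lipschitz_near_segment T n S R (\<psi>1 a) (\<psi>2 a) U"
    and pert: "\<And>s. s \<in> T \<Longrightarrow> max_norm (R *\<^sub>v \<psi>1 a s) \<le> d1 * J (\<psi>1 a s)"
    and C: "\<And>s. s \<in> T \<Longrightarrow> C s < K"
    and h: "0 < h" "h \<le> 1"
  shows "loss T C lam X (set_layer l (S + (1 - h) \<cdot>\<^sub>m R) a) - loss T C lam X a \<le>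
    h * (a_bar T d1 J (\<psi>1 a) (\<psi>2 a) U - 2 * lam * frob_inner S R - 2 * lam * (frob_norm R)\<^sup>2
         + lam * h * (frob_norm R)\<^sup>2)"
proof -
  define V where "V = S + (1 - h) \<cdot>\<^sub>m R"
  have V: "V \<in> carrier_mat n m" using S R by (simp add: V_def)
  \<comment> \<open>The segment is parametrized as \<open>S + \<theta> \<cdot>\<^sub>m R\<close>;
    its end point \<theta> = 1 has to be rewritten to match the layer matrix.\<close>
  have one: "S + 1 \<cdot>\<^sub>m R = S + R" using S R by (intro eq_matI) auto
  have l: "l < length (weights a)"
    using arch a by (auto simp: factors_through_layer_def param_space_def)
  have term_le: "ln (classifier X s a $ C s) - ln (classifier X s (set_layer l V a) $ C s)
      \<le> 2 * h * a_phi d1 J (\<psi>1 a) (\<psi>2 a) U s" if s: "s \<in> T" for s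
  proof -
    define f where "f = \<psi>1 a s"
    have f: "f \<in> carrier_vec m" using arch a by (auto simp: factors_through_layer_def f_def)
    \<comment> \<open>Used at \<theta> = 1 and \<theta> = 1 - h; the bounds on \<open>h\<close> keep
      the latter in the unit interval.\<close>
    have seg: "(S + \<theta> \<cdot>\<^sub>m R) *\<^sub>v f \<in> U s" if "\<theta> \<in> {0..1}" for \<theta>
      using lip s that unfolding lipschitz_near_segment_def f_def by blast
    have "(S + 1 \<cdot>\<^sub>m R) *\<^sub>v f \<in> U s" by (rule seg) auto
    then have SR: "(S + R) *\<^sub>v f \<in> U s" by (simp only: one)
    have VU: "V *\<^sub>v f \<in> U s" unfolding V_def by (rule seg) (use h in auto)
    have diff: "(S + R) *\<^sub>v f - V *\<^sub>v f = h \<cdot>\<^sub>v (R *\<^sub>v f)"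
      using S R f unfolding V_def
      by (intro eq_vecI)
        (auto simp: add_scalar_prod_distrib[of _ m] algebra_simps)
    have "max_norm (\<psi>2 a ((S + R) *\<^sub>v f) - \<psi>2 a (V *\<^sub>v f))
        \<le> enn2real (lip_const (\<psi>2 a) (U s)) * max_norm ((S + R) *\<^sub>v f - V *\<^sub>v f)"
      using lip s by (intro lip_const_bound[of _ n] SR VU) (auto simp: lipschitz_near_segment_def)
    also have "\<dots> \<le> enn2real (lip_const (\<psi>2 a) (U s)) * (h * (d1 * J f))"
    proof (intro mult_left_mono)
      have "max_norm ((S + R) *\<^sub>v f - V *\<^sub>v f) \<le> h * max_norm (R *\<^sub>v f)"
        unfolding diff using max_norm_smult_le[of h] h by simp
      also have "\<dots> \<le> h * (d1 * J f)"
        using pert[OF s] h by (simp add: f_def)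
      finally show "max_norm ((S + R) *\<^sub>v f - V *\<^sub>v f) \<le> h * (d1 * J f)" .
    qed auto
    also have "\<dots> = h * a_phi d1 J (\<psi>1 a) (\<psi>2 a) U s"
      by (simp add: a_phi_def h_phi_def f_def)
    finally have logits: "max_norm (\<psi>2 a ((S + R) *\<^sub>v f) - \<psi>2 a (V *\<^sub>v f))
        \<le> h * a_phi d1 J (\<psi>1 a) (\<psi>2 a) U s" .
    have "classifier X s a = softmax (\<psi>2 a ((S + R) *\<^sub>v f))"
      using arch a W by (simp add: factors_through_layer_def f_def)
    moreover have "classifier X s (set_layer l V a) = softmax (\<psi>2 a (V *\<^sub>v f))"
      using classifier_set_layer[OF arch a V] by (simp add: f_def)
    moreover have "(S + R) *\<^sub>v f \<in> carrier_vec n" "V *\<^sub>v f \<in> carrier_vec n"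
      by (intro mult_mat_vec_carrier[of _ n m] add_carrier_mat R V f)+
    then have "\<psi>2 a ((S + R) *\<^sub>v f) \<in> carrier_vec K" "\<psi>2 a (V *\<^sub>v f) \<in> carrier_vec K"
      using arch a by (auto simp: factors_through_layer_def)
    then have "\<bar>ln (softmax (\<psi>2 a ((S + R) *\<^sub>v f)) $ C s) - ln (softmax (\<psi>2 a (V *\<^sub>v f)) $ C s)\<bar>
        \<le> 2 * max_norm (\<psi>2 a ((S + R) *\<^sub>v f) - \<psi>2 a (V *\<^sub>v f))"
      by (rule ln_softmax_lipschitz[OF _ _ C[OF s]])
    ultimately show ?thesis using logits by simp
  qed
  have data: "- (1 / real (card T)) * (\<Sum>s\<in>T. ln (classifier X s (set_layer l V a) $ C s))
      - - (1 / real (card T)) * (\<Sum>s\<in>T. ln (classifier X s a $ C s))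
      \<le> h * a_bar T d1 J (\<psi>1 a) (\<psi>2 a) U" (is "?lhs \<le> _")
  proof -
    have "?lhs = (\<Sum>s\<in>T. ln (classifier X s a $ C s) - ln (classifier X s (set_layer l V a) $ C s))
        / real (card T)"
      by (simp add: sum_subtractf diff_divide_distrib)
    also have "\<dots> \<le> (\<Sum>s\<in>T. 2 * h * a_phi d1 J (\<psi>1 a) (\<psi>2 a) U s) / real (card T)"
      by (intro divide_right_mono sum_mono term_le) auto
    also have "\<dots> = h * a_bar T d1 J (\<psi>1 a) (\<psi>2 a) U"
      by (simp add: a_bar_def sum_distrib_left[symmetric])
    finally show ?thesis .
  qed
  \<comment> \<open>All layers except \<open>l\<close> cancel, so the sum of differences collapses
    to one term.\<close>
  have "(\<Sum>i<length (weights (set_layer l V a)). (frob_norm (weights (set_layer l V a) ! i))\<^sup>2)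
      - (\<Sum>i<length (weights a). (frob_norm (weights a ! i))\<^sup>2)
      = (\<Sum>i<length (weights a). if i = l then (frob_norm V)\<^sup>2 - (frob_norm (S + R))\<^sup>2 else 0)"
    unfolding set_layer_def params.sel length_list_update sum_subtractf[symmetric]
    using W by (intro sum.cong) (auto simp: nth_list_update)
  also have "\<dots> = (frob_norm V)\<^sup>2 - (frob_norm (S + R))\<^sup>2"
    using l by simp
  also have "\<dots> = h * (- 2 * frob_inner S R - 2 * (frob_norm R)\<^sup>2 + h * (frob_norm R)\<^sup>2)"
    using frob_norm_add_smult_power2[OF S R, of "1 - h"] frob_norm_add_smult_power2[OF S R, of 1]
    unfolding one by (simp add: V_def algebra_simps power2_eq_square)
  finally have reg: "lam * (\<Sum>i<length (weights (set_layer l V a)). (frob_norm (weights (set_layer l V a) ! i))\<^sup>2)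
      - lam * (\<Sum>i<length (weights a). (frob_norm (weights a ! i))\<^sup>2)
      = lam * (h * (- 2 * frob_inner S R - 2 * (frob_norm R)\<^sup>2 + h * (frob_norm R)\<^sup>2))"
    by (simp add: right_diff_distrib[symmetric])
  have "h * (a_bar T d1 J (\<psi>1 a) (\<psi>2 a) U - 2 * lam * frob_inner S R - 2 * lam * (frob_norm R)\<^sup>2
         + lam * h * (frob_norm R)\<^sup>2) = h * a_bar T d1 J (\<psi>1 a) (\<psi>2 a) U +
         lam * (h * (- 2 * frob_inner S R - 2 * (frob_norm R)\<^sup>2 + h * (frob_norm R)\<^sup>2))"
    by (simp add: algebra_simps)
  then show ?thesis using data reg unfolding loss_def V_def[symmetric] by linarith
qed

text \<open>For small \<open>h\<close> the difference quotient is at most \<open>c\<close> plus a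
  multiple of \<open>h\<close>, so its lower limit is at most \<open>c\<close>. Together with
  \<open>lim\<close> this gives \<open>- e \<le> c\<close>, an inequality linear in the squared norm
  of \<open>R\<close>, solved for it by dividing by \<open>2 * lam\<close>.\<close>

lemma frob_norm_le_of_Liminf:
  assumes arch: "factors_through_layer ds p l n m K X \<psi>1 \<psi>2"
    and a: "a \<in> param_space ds p"
    and S: "S \<in> carrier_mat n m" and R: "R \<in> carrier_mat n m"
    and W: "weights a ! l = S + R"
    and lip: "lipschitz_near_segment T n S R (\<psi>1 a) (\<psi>2 a) U"
    and pert: "\<And>s. s \<in> T \<Longrightarrow> max_norm (R *\<^sub>v \<psi>1 a s) \<le> d1 * J (\<psi>1 a s)"
    and C: "\<And>s. s \<in> T \<Longrightarrow> C s < K"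
    and lam: "lam > 0"
    and lim: "Liminf (at_right 0) (\<lambda>h. ereal
      ((loss T C lam X (set_layer l (S + (1 - h) \<cdot>\<^sub>m R) a) - loss T C lam X a) / h)) \<ge> ereal (- e)"
  shows "(frob_norm R)\<^sup>2 \<le> (a_bar T d1 J (\<psi>1 a) (\<psi>2 a) U + e) / (2 * lam) - frob_inner S R"
proof -
  define c where "c = a_bar T d1 J (\<psi>1 a) (\<psi>2 a) U - 2 * lam * frob_inner S R - 2 * lam * (frob_norm R)\<^sup>2"
  have "Liminf (at_right 0) (\<lambda>h. ereal
      ((loss T C lam X (set_layer l (S + (1 - h) \<cdot>\<^sub>m R) a) - loss T C lam X a) / h))
    \<le> Liminf (at_right 0) (\<lambda>h. ereal (c + lam * h * (frob_norm R)\<^sup>2))"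
  proof (rule Liminf_mono)
    have ev: "\<forall>\<^sub>F h in at_right 0. h \<in> {0<..<1::real}"
      by (rule eventually_at_right_real) simp
    show "\<forall>\<^sub>F h in at_right 0. ereal
      ((loss T C lam X (set_layer l (S + (1 - h) \<cdot>\<^sub>m R) a) - loss T C lam X a) / h)
      \<le> ereal (c + lam * h * (frob_norm R)\<^sup>2)"
      using ev
    proof eventually_elim
      case (elim h)
      then show ?case
        using loss_increment_le[where lam = lam and h = h, OF arch a S R W lip pert C]
        by (simp add: c_def divide_le_eq mult.commute)
    qed
  qed
  also have "Liminf (at_right 0) (\<lambda>h. ereal (c + lam * h * (frob_norm R)\<^sup>2)) = ereal c"
  proof (rule lim_imp_Liminf)
    have "((\<lambda>h. c + lam * h * (frob_norm R)\<^sup>2) \<longlongrightarrow> c + lam * 0 * (frob_norm R)\<^sup>2) (at_right 0)"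
      by (intro tendsto_intros)
    then show "((\<lambda>h. ereal (c + lam * h * (frob_norm R)\<^sup>2)) \<longlongrightarrow> ereal c) (at_right 0)" by simp
  qed simp
  finally have "- e \<le> c" using lim by (meson ereal_less_eq(3) order_trans)
  then show ?thesis using lam by (simp add: c_def field_simps)
qed

section \<open>Convergence to zero in probability\<close>

text \<open>Serves in both directions: from tails of probability near \<open>0\<close> to their
  complements, and from an event of probability near \<open>1\<close> to its exceptional
  set.\<close>

lemma measure_complement_tendsto:
  assumes prob: "\<forall>\<^sub>F i in F. prob_space (P i)"
    and A: "\<forall>\<^sub>F i in F. A i \<in> sets (P i)"
    and lim: "((\<lambda>i. measure (P i) (A i)) \<longlongrightarrow> c) F"
  shows "((\<lambda>i. measure (P i) (space (P i) - A i)) \<longlongrightarrow> 1 - c) F"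
proof (rule Lim_transform_eventually)
  show "((\<lambda>i. 1 - measure (P i) (A i)) \<longlongrightarrow> 1 - c) F" by (intro tendsto_intros lim)
  show "\<forall>\<^sub>F i in F. 1 - measure (P i) (A i) = measure (P i) (space (P i) - A i)"
    using prob A by eventually_elim (simp add: prob_space.prob_compl)
qed

text \<open>A tail event of \<open>Y\<close> lies in the same tail event of \<open>Z\<close>
  together with \<open>B\<close>. Allowing the exceptional sets \<open>B\<close> lets a bound that
  holds only with high probability be used pointwise.\<close>

lemma tendsto_0_in_prob_dominated:
  assumes prob: "\<forall>\<^sub>F i in F. prob_space (P i)"
    and Y: "\<forall>\<^sub>F i in F. Y i \<in> borel_measurable (P i)"
    and Z: "tendsto_0_in_prob P Z F"
    and B: "\<forall>\<^sub>F i in F. B i \<in> sets (P i)" "((\<lambda>i. measure (P i) (B i)) \<longlongrightarrow> 0) F"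
    and le: "\<forall>\<^sub>F i in F. \<forall>\<omega>\<in>space (P i) - B i. \<bar>Y i \<omega>\<bar> \<le> \<bar>Z i \<omega>\<bar>"
  shows "tendsto_0_in_prob P Y F"
  unfolding tendsto_0_in_prob_def
proof (intro conjI Y allI impI)
  fix e :: real assume e: "e > 0"
  have Zm: "\<forall>\<^sub>F i in F. Z i \<in> borel_measurable (P i)"
    and Zlim: "((\<lambda>i. measure (P i) {\<omega> \<in> space (P i). \<bar>Z i \<omega>\<bar> > e}) \<longlongrightarrow> 0) F"
    using Z e by (auto simp: tendsto_0_in_prob_def)
  show "((\<lambda>i. measure (P i) {\<omega> \<in> space (P i). \<bar>Y i \<omega>\<bar> > e}) \<longlongrightarrow> 0) F"
  proof (rule tendsto_sandwich)
    show "\<forall>\<^sub>F i in F. 0 \<le> measure (P i) {\<omega> \<in> space (P i). \<bar>Y i \<omega>\<bar> > e}" by simp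
    show "\<forall>\<^sub>F i in F. measure (P i) {\<omega> \<in> space (P i). \<bar>Y i \<omega>\<bar> > e} \<le>
        measure (P i) {\<omega> \<in> space (P i). \<bar>Z i \<omega>\<bar> > e} + measure (P i) (B i)"
      using prob Zm B(1) le
    proof eventually_elim
      case (elim i)
      interpret prob_space "P i" by fact
      note [measurable] = elim(2,3)
      have "measure (P i) {\<omega> \<in> space (P i). \<bar>Y i \<omega>\<bar> > e} \<le>
          measure (P i) ({\<omega> \<in> space (P i). \<bar>Z i \<omega>\<bar> > e} \<union> B i)"
        using elim(4) by (intro finite_measure_mono) force+
      also have "\<dots> \<le> measure (P i) {\<omega> \<in> space (P i). \<bar>Z i \<omega>\<bar> > e} + measure (P i) (B i)"
        by (rule measure_Un_le) measurable
      finally show ?case .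
    qed
    show "((\<lambda>i. measure (P i) {\<omega> \<in> space (P i). \<bar>Z i \<omega>\<bar> > e} + measure (P i) (B i)) \<longlongrightarrow> 0) F"
      using tendsto_add[OF Zlim B(2)] by simp
  qed auto
qed

text \<open>If the sum exceeds \<open>e\<close> in absolute value, one summand exceeds
  \<open>e / 2\<close>.\<close>

lemma tendsto_0_in_prob_add:
  assumes prob: "\<forall>\<^sub>F i in F. prob_space (P i)"
    and Y: "tendsto_0_in_prob P Y F" and Z: "tendsto_0_in_prob P Z F"
  shows "tendsto_0_in_prob P (\<lambda>i \<omega>. Y i \<omega> + Z i \<omega>) F"
  unfolding tendsto_0_in_prob_def
proof (intro conjI allI impI)
  have Ym: "\<forall>\<^sub>F i in F. Y i \<in> borel_measurable (P i)"
    and Zm: "\<forall>\<^sub>F i in F. Z i \<in> borel_measurable (P i)"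
    using Y Z by (auto simp: tendsto_0_in_prob_def)
  then show "\<forall>\<^sub>F i in F. (\<lambda>\<omega>. Y i \<omega> + Z i \<omega>) \<in> borel_measurable (P i)"
    by eventually_elim simp
  fix e :: real assume e: "e > 0"
  have lim: "((\<lambda>i. measure (P i) {\<omega> \<in> space (P i). \<bar>Y i \<omega>\<bar> > e / 2}) \<longlongrightarrow> 0) F"
    "((\<lambda>i. measure (P i) {\<omega> \<in> space (P i). \<bar>Z i \<omega>\<bar> > e / 2}) \<longlongrightarrow> 0) F"
    using Y Z e unfolding tendsto_0_in_prob_def by (meson half_gt_zero)+
  show "((\<lambda>i. measure (P i) {\<omega> \<in> space (P i). \<bar>Y i \<omega> + Z i \<omega>\<bar> > e}) \<longlongrightarrow> 0) F"
  proof (rule tendsto_sandwich)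
    show "\<forall>\<^sub>F i in F. 0 \<le> measure (P i) {\<omega> \<in> space (P i). \<bar>Y i \<omega> + Z i \<omega>\<bar> > e}" by simp
    show "\<forall>\<^sub>F i in F. measure (P i) {\<omega> \<in> space (P i). \<bar>Y i \<omega> + Z i \<omega>\<bar> > e} \<le>
        measure (P i) {\<omega> \<in> space (P i). \<bar>Y i \<omega>\<bar> > e / 2} +
        measure (P i) {\<omega> \<in> space (P i). \<bar>Z i \<omega>\<bar> > e / 2}"
      using prob Ym Zm
    proof eventually_elim
      case (elim i)
      interpret prob_space "P i" by fact
      note [measurable] = elim(2,3)
      have "measure (P i) {\<omega> \<in> space (P i). \<bar>Y i \<omega> + Z i \<omega>\<bar> > e} \<le>
          measure (P i) ({\<omega> \<in> space (P i). \<bar>Y i \<omega>\<bar> > e / 2} \<union> {\<omega> \<in> space (P i). \<bar>Z i \<omega>\<bar> > e / 2})"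
        by (intro finite_measure_mono) auto
      also have "\<dots> \<le> measure (P i) {\<omega> \<in> space (P i). \<bar>Y i \<omega>\<bar> > e / 2} +
          measure (P i) {\<omega> \<in> space (P i). \<bar>Z i \<omega>\<bar> > e / 2}"
        by (rule measure_Un_le) measurable
      finally show ?case .
    qed
    show "((\<lambda>i. measure (P i) {\<omega> \<in> space (P i). \<bar>Y i \<omega>\<bar> > e / 2} +
        measure (P i) {\<omega> \<in> space (P i). \<bar>Z i \<omega>\<bar> > e / 2}) \<longlongrightarrow> 0) F"
      using tendsto_add[OF lim] by simp
  qed auto
qed

lemma tendsto_0_in_prob_cmult:
  assumes Y: "tendsto_0_in_prob P Y F" and c: "c > 0"
  shows "tendsto_0_in_prob P (\<lambda>i \<omega>. c * Y i \<omega>) F"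
  unfolding tendsto_0_in_prob_def
proof (intro conjI allI impI)
  have "\<forall>\<^sub>F i in F. Y i \<in> borel_measurable (P i)"
    using Y by (auto simp: tendsto_0_in_prob_def)
  then show "\<forall>\<^sub>F i in F. (\<lambda>\<omega>. c * Y i \<omega>) \<in> borel_measurable (P i)"
    by eventually_elim simp
  fix e :: real assume e: "e > 0"
  have "\<bar>c * y\<bar> > e \<longleftrightarrow> \<bar>y\<bar> > e / c" for y
    using c by (simp add: abs_mult field_simps)
  then show "((\<lambda>i. measure (P i) {\<omega> \<in> space (P i). \<bar>c * Y i \<omega>\<bar> > e}) \<longlongrightarrow> 0) F"
    using Y e c by (simp add: tendsto_0_in_prob_def)
qed

lemma tendsto_0_in_prob_sum:
  assumes prob: "\<forall>\<^sub>F i in F. prob_space (P i)" and "finite T"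
    and "\<And>s. s \<in> T \<Longrightarrow> tendsto_0_in_prob P (\<lambda>i. Y i s) F"
  shows "tendsto_0_in_prob P (\<lambda>i \<omega>. \<Sum>s\<in>T. Y i s \<omega>) F"
  using assms(2,3)
proof (induction T)
  case empty
  then show ?case by (simp add: tendsto_0_in_prob_def)
next
  case (insert s T)
  then show ?case using tendsto_0_in_prob_add[OF prob, of "\<lambda>i. Y i s"] by simp
qed

lemma tendsto_0_in_prob_le_tendsto_1:
  assumes prob: "\<forall>\<^sub>F i in F. prob_space (P i)" and Y: "tendsto_0_in_prob P Y F" and e: "e > 0"
  shows "((\<lambda>i. measure (P i) {\<omega> \<in> space (P i). \<bar>Y i \<omega>\<bar> \<le> e}) \<longlongrightarrow> 1) F"
proof -
  have m: "\<forall>\<^sub>F i in F. {\<omega> \<in> space (P i). \<bar>Y i \<omega>\<bar> > e} \<in> sets (P i)"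
    using Y unfolding tendsto_0_in_prob_def by (auto elim!: eventually_mono)
  have "space (P i) - {\<omega> \<in> space (P i). \<bar>Y i \<omega>\<bar> > e} = {\<omega> \<in> space (P i). \<bar>Y i \<omega>\<bar> \<le> e}" for i
    by auto
  moreover have "((\<lambda>i. measure (P i) {\<omega> \<in> space (P i). \<bar>Y i \<omega>\<bar> > e}) \<longlongrightarrow> 0) F"
    using Y e by (auto simp: tendsto_0_in_prob_def)
  ultimately show ?thesis using measure_complement_tendsto[OF prob m, of 0] by simp
qed

text \<open>Where \<open>Y i\<close> and \<open>Z\<close> are within \<eta> of each other, they can
  lie on different sides of \<open>e\<close> only if \<open>Z\<close> is within \<eta> of
  \<open>e\<close>. Since \<open>Z\<close> has no atom at \<open>e\<close>, that event is improbable
  for small \<eta>.\<close>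

lemma (in prob_space) tendsto_cdf_of_tendsto_in_prob:
  assumes Y: "\<forall>\<^sub>F i in F. Y i \<in> borel_measurable M" and Z: "Z \<in> borel_measurable M"
    and lim: "tendsto_0_in_prob (\<lambda>i. M) (\<lambda>i \<omega>. Y i \<omega> - Z \<omega>) F"
    and null: "prob {\<omega> \<in> space M. Z \<omega> = (e :: real)} = 0"
  shows "((\<lambda>i. prob {\<omega> \<in> space M. Y i \<omega> \<le> e}) \<longlongrightarrow> prob {\<omega> \<in> space M. Z \<omega> \<le> e}) F"
proof (rule tendstoI)
  note [measurable] = Z
  fix r :: real assume r: "r > 0"
  \<comment> \<open>These neighbourhoods decrease to the null event that \<open>Z\<close> equals
    \<open>e\<close>, so continuity from above makes their probability small.\<close>
  define A where "A k = {\<omega> \<in> space M. \<bar>Z \<omega> - e\<bar> \<le> 1 / real (Suc k)}" for k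
  have "(\<lambda>k. prob (A k)) \<longlonglongrightarrow> prob (\<Inter>k. A k)"
  proof (rule finite_Lim_measure_decseq)
    show "range A \<subseteq> sets M" unfolding A_def by auto
    show "decseq A"
    proof (rule decseq_SucI)
      fix k
      have "1 / real (Suc (Suc k)) \<le> 1 / real (Suc k)" by (simp add: frac_le)
      then show "A (Suc k) \<subseteq> A k" unfolding A_def by force
    qed
  qed
  also have "(\<Inter>k. A k) = {\<omega> \<in> space M. Z \<omega> = e}"
  proof -
    have "z = e" if "\<And>k. \<bar>z - e\<bar> \<le> 1 / real (Suc k)" for z
    proof (rule ccontr)
      assume "z \<noteq> e"
      then obtain k where "inverse (real (Suc k)) < \<bar>z - e\<bar>"
        using reals_Archimedean[of "\<bar>z - e\<bar>"] by auto
      then show False using that[of k] by (simp add: inverse_eq_divide)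
    qed
    then show ?thesis unfolding A_def by auto
  qed
  finally have "(\<lambda>k. prob (A k)) \<longlonglongrightarrow> 0" using null by simp
  then have "\<forall>\<^sub>F k in sequentially. prob (A k) < r / 2"
    using r by (intro order_tendstoD(2)) auto
  then obtain k where k: "prob (A k) < r / 2" by (auto simp: eventually_sequentially)
  \<comment> \<open>With this radius the event near \<open>e\<close> is exactly \<open>A k\<close>
    and costs less than \<open>r / 2\<close>; the other half of \<open>r\<close> pays for deviations
    beyond \<eta>.\<close>
  define \<eta> where "\<eta> = 1 / real (Suc k)"
  have A_k: "A k = {\<omega> \<in> space M. \<bar>Z \<omega> - e\<bar> \<le> \<eta>}" by (simp only: A_def \<eta>_def)
  have "\<eta> > 0" by (simp add: \<eta>_def)
  then have "((\<lambda>i. prob {\<omega> \<in> space M. \<bar>Y i \<omega> - Z \<omega>\<bar> > \<eta>}) \<longlongrightarrow> 0) F"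
    using lim by (auto simp: tendsto_0_in_prob_def)
  then have "\<forall>\<^sub>F i in F. prob {\<omega> \<in> space M. \<bar>Y i \<omega> - Z \<omega>\<bar> > \<eta>} < r / 2"
    using r by (intro order_tendstoD(2)) auto
  then show "\<forall>\<^sub>F i in F. dist (prob {\<omega> \<in> space M. Y i \<omega> \<le> e}) (prob {\<omega> \<in> space M. Z \<omega> \<le> e}) < r"
    using Y
  proof eventually_elim
    case (elim i)
    note [measurable] = elim(2)
    let ?B = "{\<omega> \<in> space M. \<bar>Y i \<omega> - Z \<omega>\<bar> > \<eta>}"
    \<comment> \<open>Stated for arbitrary \<open>D\<close> and \<open>E\<close> because it is used
      twice, with the two distribution events exchanged.\<close>
    have le: "prob D \<le> prob E + prob ?B + prob (A k)"
      if "D \<in> sets M" "E \<in> sets M" "D \<subseteq> E \<union> ?B \<union> A k" for D E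
    proof -
      have [measurable]: "A k \<in> sets M" unfolding A_k by measurable
      have "prob D \<le> prob (E \<union> ?B \<union> A k)" using that by (intro finite_measure_mono) auto
      also have "\<dots> \<le> prob (E \<union> ?B) + prob (A k)" using that(2) by (intro measure_Un_le) auto
      also have "prob (E \<union> ?B) \<le> prob E + prob ?B" using that(2) by (intro measure_Un_le) auto
      finally show ?thesis by simp
    qed
    have "prob {\<omega> \<in> space M. Y i \<omega> \<le> e} \<le> prob {\<omega> \<in> space M. Z \<omega> \<le> e} + prob ?B + prob (A k)"
      by (rule le) (auto simp: A_k)
    moreover have "prob {\<omega> \<in> space M. Z \<omega> \<le> e} \<le> prob {\<omega> \<in> space M. Y i \<omega> \<le> e} + prob ?B + prob (A k)"
      by (rule le) (auto simp: A_k)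
    ultimately show ?case using elim(1) k by (simp add: dist_real_def)
  qed
qed

section \<open>The perturbation bound\<close>

text \<open>Preimages of Borel sets under a member of \<open>G\<close> are themselves
  generators.\<close>

lemma generated_sigma_measurable:
  assumes "g \<in> G"
  shows "g \<in> borel_measurable (generated_sigma P G)"
proof (rule measurableI)
  let ?\<A> = "{g -` B \<inter> space P | g B. g \<in> G \<and> B \<in> sets borel}"
  fix B :: "real set" assume "B \<in> sets borel"
  then have "g -` B \<inter> space P \<in> sigma_sets (space P) ?\<A>" using assms by blast
  moreover have "?\<A> \<subseteq> Pow (space P)" by auto
  ultimately show "g -` B \<inter> space (generated_sigma P G) \<in> sets (generated_sigma P G)"
    by (simp add: generated_sigma_def)
qed auto

text \<open>The conditional expectation of the indicator has integral \<open>prob E\<close>, so an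
  almost sure bound on it survives integration.\<close>

lemma (in prob_space) prob_le_of_real_cond_exp_le:
  assumes "subalgebra M F" "E \<in> sets M" and le: "AE \<omega> in M. real_cond_exp M F (indicator E) \<omega> \<le> d"
  shows "prob E \<le> d"
proof -
  interpret finite_measure_subalgebra M F by standard (rule assms(1))
  have int: "integrable M (indicator E :: 'a \<Rightarrow> real)"
    using assms(2) by (simp add: integrable_real_indicator emeasure_eq_measure)
  have "prob E = (\<integral>\<omega>. indicator E \<omega> \<partial>M)" using assms(2) by simp
  also have "\<dots> = (\<integral>\<omega>. real_cond_exp M F (indicator E) \<omega> \<partial>M)"
    using real_cond_exp_int(2)[OF int] by simp
  also have "\<dots> \<le> (\<integral>\<omega>. d \<partial>M)"
    by (intro integral_mono_AE le real_cond_exp_int(1)[OF int]) auto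
  finally show ?thesis by (simp add: prob_space)
qed

text \<open>The coordinates of \<open>f \<omega> s\<close> are among the generators of the
  conditioning sigma-algebra, so this vector is an admissible choice of \<open>v\<close>. Averaging
  then removes the conditioning.\<close>

lemma perturbation_bound_prob:
  assumes P: "prob_space P" and pb: "perturbation_bound P n m K d1 d2 J S R f g"
    and f: "\<And>\<omega>. \<omega> \<in> space P \<Longrightarrow> f \<omega> s \<in> carrier_vec m"
  defines "E \<equiv> {\<omega> \<in> space P. max_norm (R \<omega> *\<^sub>v f \<omega> s) > d1 * J (f \<omega> s)}"
  shows "E \<in> sets P" "measure P E \<le> d2"
proof -
  interpret prob_space P by fact
  let ?F = "decomposition_sigma P n m K S f g"
  have sub: "subalgebra P ?F" using pb by (simp add: perturbation_bound_def Let_def)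
  have "random_vec ?F m (\<lambda>\<omega>. f \<omega> s)"
    unfolding random_vec_def
  proof (intro conjI ballI allI impI)
    fix \<omega> assume "\<omega> \<in> space ?F"
    then show "f \<omega> s \<in> carrier_vec m" using sub f by (simp add: subalgebra_def)
  next
    fix i assume "i < m"
    then show "(\<lambda>\<omega>. f \<omega> s $ i) \<in> borel_measurable ?F"
      unfolding decomposition_sigma_def by (intro generated_sigma_measurable) blast
  qed
  then have *: "E \<in> sets P \<and> (AE \<omega> in P. real_cond_exp P ?F (indicator E) \<omega> \<le> d2)"
    using pb unfolding perturbation_bound_def Let_def E_def by blast
  then show "E \<in> sets P" by simp
  show "measure P E \<le> d2" using * by (intro prob_le_of_real_cond_exp_le[OF sub]) auto
qed

text \<open>The error \<delta> is the explicit form of the term that is small in probability. The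
  iterated limit is split by naming the inner limits \<open>q N\<close>, whose existence is thus
  part of the claim.\<close>

theorem theorem4p7:
  fixes P :: "nat \<Rightarrow> 'w measure"
    and T :: "'s set" and C :: "'s \<Rightarrow> nat" and K :: nat and lam :: real
    and ds :: "nat \<Rightarrow> (nat \<times> nat) list" and p :: "nat \<Rightarrow> nat"
    and l :: "nat \<Rightarrow> nat" and M :: "nat \<Rightarrow> nat"
    and X :: "nat \<Rightarrow> 's \<Rightarrow> params \<Rightarrow> real vec"
    and \<psi>1 :: "nat \<Rightarrow> params \<Rightarrow> 's \<Rightarrow> real vec"
    and \<psi>2 :: "nat \<Rightarrow> params \<Rightarrow> real vec \<Rightarrow> real vec"
    and \<alpha> :: "real \<Rightarrow> nat \<Rightarrow> 'w \<Rightarrow> params" and \<alpha>s :: "nat \<Rightarrow> 'w \<Rightarrow> params"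
    and Ss Rs :: "nat \<Rightarrow> 'w \<Rightarrow> real mat"
    and U :: "nat \<Rightarrow> 'w \<Rightarrow> 's \<Rightarrow> real vec set"
    and d1 d2 :: "nat \<Rightarrow> real" and J :: "real vec \<Rightarrow> real"
    and \<epsilon> :: "nat \<Rightarrow> 'w \<Rightarrow> real"
    and a :: "nat \<Rightarrow> 's \<Rightarrow> 'w \<Rightarrow> real" and abar :: "nat \<Rightarrow> 'w \<Rightarrow> real"
  defines "a \<equiv> \<lambda>N s \<omega>. a_phi (d1 N) J (\<psi>1 N (\<alpha>s N \<omega>)) (\<psi>2 N (\<alpha>s N \<omega>)) (U N \<omega>) s"
    and "abar \<equiv> \<lambda>N \<omega>. a_bar T (d1 N) J (\<psi>1 N (\<alpha>s N \<omega>)) (\<psi>2 N (\<alpha>s N \<omega>)) (U N \<omega>)"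
  assumes prob: "\<And>N. N \<ge> 1 \<Longrightarrow> prob_space (P N)"
    and T: "finite T" "T \<noteq> {}" and C: "\<And>s. s \<in> T \<Longrightarrow> C s < K"
    and lam: "lam > 0"
    and path_random: "\<And>t N. t \<ge> 0 \<Longrightarrow> N \<ge> 1 \<Longrightarrow> random_params (P N) (ds N) (p N) (\<alpha> t N)"
    and limit_random: "\<And>N. N \<ge> 1 \<Longrightarrow> random_params (P N) (ds N) (p N) (\<alpha>s N)"
    and path_limit: "\<And>N. N \<ge> 1 \<Longrightarrow>
          tendsto_0_in_prob (\<lambda>t. P N) (\<lambda>t \<omega>. param_dist (\<alpha> t N \<omega>) (\<alpha>s N \<omega>)) at_top"
    and architecture: "\<And>N. N \<ge> 1 \<Longrightarrow>
          factors_through_layer (ds N) (p N) (l N) N (M N) K (X N) (\<psi>1 N) (\<psi>2 N)"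
    and S_random: "\<And>N. N \<ge> 1 \<Longrightarrow> random_mat (P N) N (M N) (Ss N)"
    and R_random: "\<And>N. N \<ge> 1 \<Longrightarrow> random_mat (P N) N (M N) (Rs N)"
    and decomposition: "\<And>N \<omega>. N \<ge> 1 \<Longrightarrow> \<omega> \<in> space (P N) \<Longrightarrow>
          weights (\<alpha>s N \<omega>) ! l N = Ss N \<omega> + Rs N \<omega>"
    and lipschitz: "\<And>N \<omega>. N \<ge> 1 \<Longrightarrow> \<omega> \<in> space (P N) \<Longrightarrow>
          lipschitz_near_segment T N (Ss N \<omega>) (Rs N \<omega>)
            (\<psi>1 N (\<alpha>s N \<omega>)) (\<psi>2 N (\<alpha>s N \<omega>)) (U N \<omega>)"
    and perturbative: "perturbative_random_component P M K d1 d2 J Ss Rs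
          (\<lambda>N \<omega>. \<psi>1 N (\<alpha>s N \<omega>)) (\<lambda>N \<omega>. \<psi>2 N (\<alpha>s N \<omega>))"
    and orthogonal: "tendsto_0_in_prob P (\<lambda>N \<omega>. frob_inner (Ss N \<omega>) (Rs N \<omega>)) sequentially"
    and a_limit: "\<And>s. s \<in> T \<Longrightarrow> tendsto_0_in_prob P (\<lambda>N. a N s) sequentially"
    and eps_random: "\<And>N. N \<ge> 1 \<Longrightarrow> \<epsilon> N \<in> borel_measurable (P N)"
    and eps_nonneg: "\<And>N \<omega>. N \<ge> 1 \<Longrightarrow> \<omega> \<in> space (P N) \<Longrightarrow> \<epsilon> N \<omega> \<ge> 0"
    and eps_limit: "tendsto_0_in_prob P \<epsilon> sequentially"
    and almost_minimal: "(\<lambda>N. measure (P N) {\<omega> \<in> space (P N).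
          Liminf (at_right 0) (\<lambda>h. ereal
            ((loss T C lam (X N) (set_layer (l N) (Ss N \<omega> + (1 - h) \<cdot>\<^sub>m Rs N \<omega>) (\<alpha>s N \<omega>))
              - loss T C lam (X N) (\<alpha>s N \<omega>)) / h))
          \<ge> ereal (- \<epsilon> N \<omega>)}) \<longlonglongrightarrow> 1"
  shows
    "(\<exists>\<delta>. (\<forall>N\<ge>1. \<delta> N \<in> borel_measurable (P N)) \<and> tendsto_0_in_prob P \<delta> sequentially \<and>
        (\<forall>N\<ge>1. \<forall>\<omega>\<in>space (P N).
           (frob_norm (Rs N \<omega>))\<^sup>2 \<le> (abar N \<omega> + \<epsilon> N \<omega>) / (2 * lam) + \<delta> N \<omega>)) \<and>
     (tendsto_0_in_prob P (\<lambda>N \<omega>. abar N \<omega> + \<epsilon> N \<omega>) sequentially \<longrightarrow>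
        (\<forall>e>0. (\<lambda>N. measure (P N) {\<omega> \<in> space (P N). frob_norm (Rs N \<omega>) \<le> e}) \<longlonglongrightarrow> 1)) \<and>
     (\<forall>S R :: real \<Rightarrow> nat \<Rightarrow> 'w \<Rightarrow> real mat.
        (\<forall>N\<ge>1. \<forall>t\<ge>0. random_mat (P N) N (M N) (S t N) \<and> random_mat (P N) N (M N) (R t N)) \<and>
        (\<forall>N\<ge>1. \<forall>t\<ge>0. \<forall>\<omega>\<in>space (P N). weights (\<alpha> t N \<omega>) ! l N = S t N \<omega> + R t N \<omega>) \<and>
        (\<forall>N\<ge>1. tendsto_0_in_prob (\<lambda>t. P N)
           (\<lambda>t \<omega>. frob_norm (S t N \<omega> - Ss N \<omega>) + frob_norm (R t N \<omega> - Rs N \<omega>)) at_top) \<and>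
        (\<forall>N\<ge>1. \<forall>e>0. measure (P N) {\<omega> \<in> space (P N). frob_norm (Rs N \<omega>) = e} = 0) \<longrightarrow>
        (\<forall>e>0. \<exists>q. (\<forall>N\<ge>1.
             ((\<lambda>t. measure (P N) {\<omega> \<in> space (P N). frob_norm (R t N \<omega>) \<le> e}) \<longlongrightarrow> q N) at_top) \<and>
           q \<longlonglongrightarrow> 1))"
proof -

  \<comment> \<open>Basic properties of the random quantities\<close>
  have prob_ev: "\<forall>\<^sub>F N in sequentially. prob_space (P N)"
    using prob by (auto simp: eventually_sequentially)
  have d: "d1 N \<ge> 0" "d2 N \<ge> 0" "J v \<ge> 0" if "N \<ge> 1" for N v
    using perturbative that by (auto simp: perturbative_random_component_def)
  have d2_limit: "d2 \<longlonglongrightarrow> 0"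
    using perturbative by (simp add: perturbative_random_component_def)
  have \<alpha>s_in: "\<alpha>s N \<omega> \<in> param_space (ds N) (p N)" if "N \<ge> 1" "\<omega> \<in> space (P N)" for N \<omega>
    using limit_random that by (auto simp: random_params_def)
  have carrier: "Ss N \<omega> \<in> carrier_mat N (M N)" "Rs N \<omega> \<in> carrier_mat N (M N)"
    if "N \<ge> 1" "\<omega> \<in> space (P N)" for N \<omega>
    using S_random R_random that by (auto simp: random_mat_def)
  have R_meas: "(\<lambda>\<omega>. frob_norm (Rs N \<omega>)) \<in> borel_measurable (P N)" if "N \<ge> 1" for N
    by (rule frob_norm_measurable[OF R_random[OF that]])
  have abar_eq: "abar N = (\<lambda>\<omega>. 2 / real (card T) * (\<Sum>s\<in>T. a N s \<omega>))" for N
    by (simp add: abar_def a_def a_bar_def)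
  have abar_nonneg: "abar N \<omega> \<ge> 0" if "N \<ge> 1" for N \<omega>
    unfolding abar_eq a_def a_phi_def h_phi_def
    by (intro mult_nonneg_nonneg sum_nonneg d that) auto
  \<comment> \<open>As \<open>T\<close> is finite and nonempty, \<open>abar\<close> is a positive
    multiple of a finite sum of null sequences.\<close>
  have abar_limit: "tendsto_0_in_prob P abar sequentially"
    unfolding abar_eq using T
    by (intro tendsto_0_in_prob_cmult tendsto_0_in_prob_sum prob_ev a_limit)
      (auto simp: card_gt_0_iff)
  then have abar_meas: "\<forall>\<^sub>F N in sequentially. abar N \<in> borel_measurable (P N)"
    by (simp add: tendsto_0_in_prob_def)

  \<comment> \<open>The error term\<close>
  define bound where "bound N \<omega> = (abar N \<omega> + \<epsilon> N \<omega>) / (2 * lam)" for N \<omega>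
  have bound_nonneg: "bound N \<omega> \<ge> 0" if "N \<ge> 1" "\<omega> \<in> space (P N)" for N \<omega>
    using abar_nonneg eps_nonneg that lam by (simp add: bound_def)
  text \<open>The hypotheses give measurability of \<open>abar N\<close> for large \<open>N\<close> only; for the other \<open>N\<close> the error
    \<open>\<delta> N\<close> must not depend on \<open>abar N\<close>.\<close>
  define \<delta> where "\<delta> N \<omega> = (if abar N \<in> borel_measurable (P N)
      then max 0 ((frob_norm (Rs N \<omega>))\<^sup>2 - bound N \<omega>) else (frob_norm (Rs N \<omega>))\<^sup>2)" for N \<omega>
  have \<delta>_meas: "\<delta> N \<in> borel_measurable (P N)" if "N \<ge> 1" for N
  proof -
    note [measurable] = R_meas[OF that] eps_random[OF that]
    show ?thesis
    proof (cases "abar N \<in> borel_measurable (P N)")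
      case True
      note [measurable] = True
      show ?thesis unfolding \<delta>_def bound_def using True by simp
    qed (simp add: \<delta>_def[abs_def])
  qed
  have \<delta>_bound: "(frob_norm (Rs N \<omega>))\<^sup>2 \<le> bound N \<omega> + \<delta> N \<omega>" if "N \<ge> 1" "\<omega> \<in> space (P N)" for N \<omega>
    using bound_nonneg[OF that] by (auto simp: \<delta>_def)

  \<comment> \<open>The exceptional events\<close>
  define A where "A N = {\<omega> \<in> space (P N).
      Liminf (at_right 0) (\<lambda>h. ereal
        ((loss T C lam (X N) (set_layer (l N) (Ss N \<omega> + (1 - h) \<cdot>\<^sub>m Rs N \<omega>) (\<alpha>s N \<omega>))
          - loss T C lam (X N) (\<alpha>s N \<omega>)) / h)) \<ge> ereal (- \<epsilon> N \<omega>)}" for N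
  have A_limit: "(\<lambda>N. measure (P N) (A N)) \<longlonglongrightarrow> 1"
    using almost_minimal by (simp add: A_def)
  \<comment> \<open>That \<open>A N\<close> is an event for large \<open>N\<close> is extracted from
    the limit: \<open>measure\<close> is \<open>0\<close> on sets that are not events, so a positive
    value forces measurability.\<close>
  then have "\<forall>\<^sub>F N in sequentially. 0 < measure (P N) (A N)"
    by (rule order_tendstoD) simp
  then have A_sets: "\<forall>\<^sub>F N in sequentially. A N \<in> sets (P N)"
    by eventually_elim (metis less_irrefl measure_notin_sets)
  define E where "E N s = {\<omega> \<in> space (P N).
      max_norm (Rs N \<omega> *\<^sub>v \<psi>1 N (\<alpha>s N \<omega>) s) > d1 N * J (\<psi>1 N (\<alpha>s N \<omega>) s)}" for N s
  have E: "E N s \<in> sets (P N)" "measure (P N) (E N s) \<le> d2 N" if N: "N \<ge> 1" for N s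
  proof -
    have pb: "perturbation_bound (P N) N (M N) K (d1 N) (d2 N) J (Ss N) (Rs N)
        (\<lambda>\<omega>. \<psi>1 N (\<alpha>s N \<omega>)) (\<lambda>\<omega>. \<psi>2 N (\<alpha>s N \<omega>))"
      using perturbative N by (simp add: perturbative_random_component_def)
    have "\<psi>1 N (\<alpha>s N \<omega>) s \<in> carrier_vec (M N)" if "\<omega> \<in> space (P N)" for \<omega>
      using architecture[OF N] \<alpha>s_in[OF N that] by (simp add: factors_through_layer_def)
    then show "E N s \<in> sets (P N)" "measure (P N) (E N s) \<le> d2 N"
      using perturbation_bound_prob[OF prob[OF N] pb] unfolding E_def by blast+
  qed
  \<comment> \<open>Off \<open>B N\<close>, almost-minimality and the perturbation bounds for all
    training points hold together. The union bound costs at most \<open>card T * d2 N\<close> for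
    the latter, with \<open>card T\<close> independent of \<open>N\<close>.\<close>
  define B where "B N = (space (P N) - A N) \<union> (\<Union>s\<in>T. E N s)" for N
  have B_sets: "\<forall>\<^sub>F N in sequentially. B N \<in> sets (P N)"
    using A_sets eventually_ge_at_top[of 1]
    unfolding B_def by eventually_elim (intro sets.Un sets.compl_sets sets.finite_UN T E)
  have B_limit: "(\<lambda>N. measure (P N) (B N)) \<longlonglongrightarrow> 0"
  proof (rule tendsto_sandwich[where f = "\<lambda>_. 0"])
    show "\<forall>\<^sub>F N in sequentially. measure (P N) (B N) \<le>
        measure (P N) (space (P N) - A N) + real (card T) * d2 N"
      using A_sets eventually_ge_at_top[of 1]
    proof eventually_elim
      case (elim N)
      interpret prob_space "P N" by (rule prob[OF elim(2)])
      have "measure (P N) (B N) \<le> measure (P N) (space (P N) - A N) + measure (P N) (\<Union>s\<in>T. E N s)"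
        unfolding B_def using elim T E by (intro measure_Un_le) auto
      also have "measure (P N) (\<Union>s\<in>T. E N s) \<le> (\<Sum>s\<in>T. measure (P N) (E N s))"
        using elim T E by (intro measure_UNION_le) auto
      also have "\<dots> \<le> real (card T) * d2 N"
        using elim E by (intro sum_bounded_above) auto
      finally show ?case by simp
    qed
    have "(\<lambda>N. measure (P N) (space (P N) - A N) + real (card T) * d2 N) \<longlonglongrightarrow>
        (1 - 1) + real (card T) * 0"
      by (intro tendsto_intros d2_limit measure_complement_tendsto[OF prob_ev A_sets A_limit])
    then show "(\<lambda>N. measure (P N) (space (P N) - A N) + real (card T) * d2 N) \<longlonglongrightarrow> 0" by simp
  qed auto
  \<comment> \<open>Off \<open>B N\<close> the squared norm exceeds \<open>bound N \<omega>\<close>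
    by at most minus the inner product of \<open>Ss\<close> and \<open>Rs\<close>. So \<delta> is
    dominated there by the absolute inner product, once \<open>N\<close> is large enough for the
    first branch of its definition.\<close>
  have \<delta>_limit: "tendsto_0_in_prob P \<delta> sequentially"
  proof (rule tendsto_0_in_prob_dominated[OF prob_ev _ orthogonal B_sets B_limit])
    show "\<forall>\<^sub>F N in sequentially. \<delta> N \<in> borel_measurable (P N)"
      using \<delta>_meas by (auto simp: eventually_sequentially)
    show "\<forall>\<^sub>F N in sequentially. \<forall>\<omega>\<in>space (P N) - B N. \<bar>\<delta> N \<omega>\<bar> \<le> \<bar>frob_inner (Ss N \<omega>) (Rs N \<omega>)\<bar>"
      using abar_meas eventually_ge_at_top[of 1]
    proof eventually_elim
      case (elim N)
      show ?case
      proof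
        fix \<omega> assume \<omega>: "\<omega> \<in> space (P N) - B N"
        then have sp: "\<omega> \<in> space (P N)" and "\<omega> \<in> A N" and notE: "\<And>s. s \<in> T \<Longrightarrow> \<omega> \<notin> E N s"
          by (auto simp: B_def)
        have lim: "Liminf (at_right 0) (\<lambda>h. ereal
            ((loss T C lam (X N) (set_layer (l N) (Ss N \<omega> + (1 - h) \<cdot>\<^sub>m Rs N \<omega>) (\<alpha>s N \<omega>))
              - loss T C lam (X N) (\<alpha>s N \<omega>)) / h)) \<ge> ereal (- \<epsilon> N \<omega>)"
          using \<open>\<omega> \<in> A N\<close> unfolding A_def by blast
        have "(frob_norm (Rs N \<omega>))\<^sup>2 \<le> bound N \<omega> - frob_inner (Ss N \<omega>) (Rs N \<omega>)"
          unfolding bound_def abar_def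
        proof (rule frob_norm_le_of_Liminf[OF architecture[OF elim(2)] \<alpha>s_in[OF elim(2) sp]
              carrier[OF elim(2) sp] decomposition[OF elim(2) sp] lipschitz[OF elim(2) sp] _ C lam lim])
          show "max_norm (Rs N \<omega> *\<^sub>v \<psi>1 N (\<alpha>s N \<omega>) s) \<le> d1 N * J (\<psi>1 N (\<alpha>s N \<omega>) s)"
            if "s \<in> T" for s
            using notE[OF that] sp by (simp add: E_def)
        qed
        then show "\<bar>\<delta> N \<omega>\<bar> \<le> \<bar>frob_inner (Ss N \<omega>) (Rs N \<omega>)\<bar>"
          using elim(1) by (simp add: \<delta>_def)
      qed
    qed
  qed

  \<comment> \<open>Vanishing of the random component\<close>
  have norm_tail: "(\<lambda>N. measure (P N) {\<omega> \<in> space (P N). frob_norm (Rs N \<omega>) \<le> e}) \<longlonglongrightarrow> 1"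
    if sum_limit: "tendsto_0_in_prob P (\<lambda>N \<omega>. abar N \<omega> + \<epsilon> N \<omega>) sequentially" and e: "e > 0" for e
  proof -
    have "tendsto_0_in_prob P (\<lambda>N \<omega>. 1 / (2 * lam) * (abar N \<omega> + \<epsilon> N \<omega>) + \<delta> N \<omega>) sequentially"
      using lam by (intro tendsto_0_in_prob_add tendsto_0_in_prob_cmult prob_ev sum_limit \<delta>_limit) auto
    then have total: "tendsto_0_in_prob P (\<lambda>N \<omega>. bound N \<omega> + \<delta> N \<omega>) sequentially"
      by (simp add: bound_def)
    \<comment> \<open>The bound with error \<delta> holds at every point of the space, so the
      exceptional sets are empty here.\<close>
    have "tendsto_0_in_prob P (\<lambda>N \<omega>. (frob_norm (Rs N \<omega>))\<^sup>2) sequentially"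
    proof (rule tendsto_0_in_prob_dominated[OF prob_ev _ total, where B = "\<lambda>N. {}"])
      show "\<forall>\<^sub>F N in sequentially. (\<lambda>\<omega>. (frob_norm (Rs N \<omega>))\<^sup>2) \<in> borel_measurable (P N)"
        using eventually_ge_at_top[of 1] by eventually_elim (intro borel_measurable_power R_meas)
      show "\<forall>\<^sub>F N in sequentially. \<forall>\<omega>\<in>space (P N) - {}.
          \<bar>(frob_norm (Rs N \<omega>))\<^sup>2\<bar> \<le> \<bar>bound N \<omega> + \<delta> N \<omega>\<bar>"
        using eventually_ge_at_top[of 1] 
      proof eventually_elim
        case (elim N)
        have "\<bar>(frob_norm (Rs N \<omega>))\<^sup>2\<bar> \<le> \<bar>bound N \<omega> + \<delta> N \<omega>\<bar>" if "\<omega> \<in> space (P N)" for \<omega>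
          using \<delta>_bound[OF elim that] by simp
        then show ?case by blast
      qed
    qed auto
    then have "(\<lambda>N. measure (P N) {\<omega> \<in> space (P N). \<bar>(frob_norm (Rs N \<omega>))\<^sup>2\<bar> \<le> e\<^sup>2}) \<longlonglongrightarrow> 1"
      using e by (intro tendsto_0_in_prob_le_tendsto_1 prob_ev) auto
    moreover have "\<bar>(frob_norm D)\<^sup>2\<bar> \<le> e\<^sup>2 \<longleftrightarrow> frob_norm D \<le> e" for D
      using e frob_norm_nonneg[of D] by (simp add: abs_le_square_iff[symmetric])
    ultimately show ?thesis by simp
  qed

  \<comment> \<open>The random component along the training path\<close>
  have path: "\<exists>q. (\<forall>N\<ge>1.
        ((\<lambda>t. measure (P N) {\<omega> \<in> space (P N). frob_norm (R t N \<omega>) \<le> e}) \<longlongrightarrow> q N) at_top) \<and> q \<longlonglongrightarrow> 1"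
    if rand: "\<forall>N\<ge>1. \<forall>t\<ge>0. random_mat (P N) N (M N) (S t N) \<and> random_mat (P N) N (M N) (R t N)"
      and lim: "\<forall>N\<ge>1. tendsto_0_in_prob (\<lambda>t. P N)
        (\<lambda>t \<omega>. frob_norm (S t N \<omega> - Ss N \<omega>) + frob_norm (R t N \<omega> - Rs N \<omega>)) at_top"
      and null: "\<forall>N\<ge>1. \<forall>e>0. measure (P N) {\<omega> \<in> space (P N). frob_norm (Rs N \<omega>) = e} = 0"
      and e: "e > 0"
    for S R :: "real \<Rightarrow> nat \<Rightarrow> 'w \<Rightarrow> real mat" and e
  proof (intro exI conjI allI impI)
    \<comment> \<open>The inner limit is the distribution function of the norm of
      \<open>Rs N\<close> at \<open>e\<close>. It tends to \<open>1\<close> because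
      \<open>abar\<close> and \<epsilon> both tend to \<open>0\<close> in probability.\<close>
    show "(\<lambda>N. measure (P N) {\<omega> \<in> space (P N). frob_norm (Rs N \<omega>) \<le> e}) \<longlonglongrightarrow> 1"
      by (intro norm_tail tendsto_0_in_prob_add prob_ev abar_limit eps_limit e)
    fix N :: nat assume N: "N \<ge> 1"
    interpret prob_space "P N" by (rule prob[OF N])
    have R_t: "(\<lambda>\<omega>. frob_norm (R t N \<omega>)) \<in> borel_measurable (P N)" if "t \<ge> 0" for t
      by (rule frob_norm_measurable) (use rand N that in blast)
    \<comment> \<open>The difference of norms is bounded by the norm of
      \<open>R t N \<omega> - Rs N \<omega>\<close>; the nonnegative term for \<open>S\<close> is
      added to reach the quantity known to converge.\<close>
    have "tendsto_0_in_prob (\<lambda>t. P N) (\<lambda>t \<omega>. frob_norm (R t N \<omega>) - frob_norm (Rs N \<omega>)) at_top"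
    proof (rule tendsto_0_in_prob_dominated[OF _ _ lim[rule_format, OF N], where B = "\<lambda>t. {}"])
      show "\<forall>\<^sub>F t in at_top. (\<lambda>\<omega>. frob_norm (R t N \<omega>) - frob_norm (Rs N \<omega>)) \<in> borel_measurable (P N)"
        using eventually_ge_at_top[of 0] by eventually_elim (use R_t R_meas N in simp)
      show "\<forall>\<^sub>F t in at_top. \<forall>\<omega>\<in>space (P N) - {}. \<bar>frob_norm (R t N \<omega>) - frob_norm (Rs N \<omega>)\<bar> \<le>
          \<bar>frob_norm (S t N \<omega> - Ss N \<omega>) + frob_norm (R t N \<omega> - Rs N \<omega>)\<bar>"
        using eventually_ge_at_top[of 0]
      proof eventually_elim
        case (elim t)
        show ?case
        proof
          fix \<omega> assume "\<omega> \<in> space (P N) - {}"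
          then have "\<bar>frob_norm (R t N \<omega>) - frob_norm (Rs N \<omega>)\<bar> \<le> frob_norm (R t N \<omega> - Rs N \<omega>)"
            using rand N elim carrier[OF N, of \<omega>] by (intro frob_norm_diff_le) (auto simp: random_mat_def)
          then show "\<bar>frob_norm (R t N \<omega>) - frob_norm (Rs N \<omega>)\<bar> \<le>
              \<bar>frob_norm (S t N \<omega> - Ss N \<omega>) + frob_norm (R t N \<omega> - Rs N \<omega>)\<bar>"
            using frob_norm_nonneg[of "S t N \<omega> - Ss N \<omega>"] by linarith
        qed
      qed
    qed (simp_all add: prob_space_axioms)
    then show "((\<lambda>t. prob {\<omega> \<in> space (P N). frob_norm (R t N \<omega>) \<le> e}) \<longlongrightarrow>
        prob {\<omega> \<in> space (P N). frob_norm (Rs N \<omega>) \<le> e}) at_top"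
      using null N e R_t
      by (intro tendsto_cdf_of_tendsto_in_prob R_meas) (auto intro: eventually_at_top_linorderI[of 0])
  qed

  show ?thesis
  proof (intro conjI impI allI)
    show "\<exists>\<delta>. (\<forall>N\<ge>1. \<delta> N \<in> borel_measurable (P N)) \<and> tendsto_0_in_prob P \<delta> sequentially \<and>
        (\<forall>N\<ge>1. \<forall>\<omega>\<in>space (P N).
           (frob_norm (Rs N \<omega>))\<^sup>2 \<le> (abar N \<omega> + \<epsilon> N \<omega>) / (2 * lam) + \<delta> N \<omega>)"
      by (intro exI[of _ \<delta>] conjI allI impI ballI \<delta>_meas \<delta>_limit \<delta>_bound[unfolded bound_def])
  qed (erule norm_tail, assumption, (elim conjE, rule path; assumption))
qed

end
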